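(* Let $a,b,c,d$ be circles in the plane. If $abc\to d$ is a tight implication, then the circles $a,c,d$ are in configuration 3, or they are in limit case 2 with $d$ at the center.
   Context: A circle means a closed disc in $\mathbb{R}^2$ (boundary included), possibly of radius $0$; a circle is identified with its point set. For circles, $\mathrm{CH}(x_1,\dots,x_k)$ is the convex hull of the union of their point sets. The implication $Y\to u$ (for a set $Y$ of circles written as a word) means $u\subseteq\mathrm{CH}(Y)$; it is tight if it holds and $u\not\subseteq\mathrm{CH}(Y\setminus\{z\})$ for every $z\in Y$. Configurations: for three circles none of which is contained in another, they are in configuration 1 if for some labeling $x,y,z$ of them $\mathrm{CH}(x,y,z)=\mathrm{CH}(y,z)$; in configuration 2 if not in configuration 1 and for some labeling $\mathrm{CH}(x,y,z)=\mathrm{CH}(x,y)\cup\mathrm{CH}(y,z)$; in configuration 3 if $\mathrm{CH}(x,y,z)\neq\mathrm{CH}(x,y)\cup\mathrm{CH}(x,z)$ for every labeling. In configurations 1 or 2, the circle $y$ is called the center if $\mathrm{CH}(x,y,z)=\mathrm{CH}(x,y)\cup\mathrm{CH}(y,z)$ or $y\subseteq\mathrm{CH}(x,z)$. Three circles $x,y,z$ are in limit case 2 (with $y$ at the center) if they are in configuration 2 with center $y$ and $y$ has exactly one (touching) point in common with one of the two outer common tangent lines of $x$ and $z$, and meets the other of these tangent lines in two points.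
   Formalization: The circles a, b, c are taken to be distinct; and when a and c both have radius 0, so that their two outer common tangent lines coincide, limit case 2 asks only that d touch this line in exactly one point. *)

theory Defs
  imports "HOL-Analysis.Analysis"
begin

text \<open>A circle is a closed disc of the plane, given as a point set; radius 0 is allowed.\<close>

definition is_circle :: "(real^2) set \<Rightarrow> bool" where
  "is_circle x \<longleftrightarrow> (\<exists>p r. r \<ge> 0 \<and> x = cball p r)"

definition CH :: "(real^2) set set \<Rightarrow> (real^2) set" where
  "CH Y = convex hull (\<Union>Y)"

definition implication :: "(real^2) set set \<Rightarrow> (real^2) set \<Rightarrow> bool" where
  "implication Y u \<longleftrightarrow> u \<subseteq> CH Y"

definition tight_implication :: "(real^2) set set \<Rightarrow> (real^2) set \<Rightarrow> bool" where
  "tight_implication Y u \<longleftrightarrow> implication Y u \<and> (\<forall>z\<in>Y. \<not> u \<subseteq> CH (Y - {z}))"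

text \<open>The standing assumption in the definition of the three configurations.\<close>

definition incomparable_circles :: "(real^2) set \<Rightarrow> (real^2) set \<Rightarrow> (real^2) set \<Rightarrow> bool" where
  "incomparable_circles x y z \<longleftrightarrow>
     is_circle x \<and> is_circle y \<and> is_circle z \<and> distinct [x, y, z] \<and>
     pairwise (\<lambda>u v. \<not> u \<subseteq> v) {x, y, z}"

text \<open>The configurations do not depend on the order of the three arguments. As these are distinct,
  \<open>{x, y, z} = {a, b, c}\<close> says that \<open>x, y, z\<close> is a relabeling of \<open>a, b, c\<close>.\<close>

definition configuration1 :: "(real^2) set \<Rightarrow> (real^2) set \<Rightarrow> (real^2) set \<Rightarrow> bool" where
  "configuration1 a b c \<longleftrightarrow> incomparable_circles a b c \<and>
     (\<exists>x y z. {x, y, z} = {a, b, c} \<and> CH {x, y, z} = CH {y, z})"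

definition configuration2 :: "(real^2) set \<Rightarrow> (real^2) set \<Rightarrow> (real^2) set \<Rightarrow> bool" where
  "configuration2 a b c \<longleftrightarrow> incomparable_circles a b c \<and> \<not> configuration1 a b c \<and>
     (\<exists>x y z. {x, y, z} = {a, b, c} \<and> CH {x, y, z} = CH {x, y} \<union> CH {y, z})"

definition configuration3 :: "(real^2) set \<Rightarrow> (real^2) set \<Rightarrow> (real^2) set \<Rightarrow> bool" where
  "configuration3 a b c \<longleftrightarrow> incomparable_circles a b c \<and>
     (\<forall>x y z. {x, y, z} = {a, b, c} \<longrightarrow> CH {x, y, z} \<noteq> CH {x, y} \<union> CH {x, z})"

text \<open>The middle argument is the center.\<close>

definition is_center :: "(real^2) set \<Rightarrow> (real^2) set \<Rightarrow> (real^2) set \<Rightarrow> bool" where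
  "is_center x y z \<longleftrightarrow>
     (configuration1 x y z \<or> configuration2 x y z) \<and>
     (CH {x, y, z} = CH {x, y} \<union> CH {y, z} \<or> y \<subseteq> CH {x, z})"

text \<open>A line is tangent to a disc iff they have exactly one common point; for a disc of radius 0
  this means passing through it. The tangent is outer if both discs lie on the same side.\<close>

definition outer_common_tangent :: "(real^2) set \<Rightarrow> (real^2) set \<Rightarrow> (real^2) set \<Rightarrow> bool" where
  "outer_common_tangent x z L \<longleftrightarrow>
     (\<exists>n t. n \<noteq> 0 \<and> L = {p. n \<bullet> p = t} \<and> x \<union> z \<subseteq> {p. n \<bullet> p \<le> t}) \<and>
     card (x \<inter> L) = 1 \<and> card (z \<inter> L) = 1"

text \<open>The middle argument is at the center. Circles \<open>x, z\<close> not containing each other have exactly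
  two outer common tangent lines \<open>L1 \<noteq> L2\<close>, except when both have radius 0: then the two tangents
  coincide, \<open>L1 = L2\<close> is the line through the two points, and there is no other tangent to be met
  in two points, so that only the touching condition remains. (This degenerate case does occur: take for
  \<open>x, z\<close> two vertices of a triangle and for \<open>y\<close> its incircle.) Since \<open>y\<close> is a disc, meeting a line in
  two points is expressed with its boundary \<open>frontier y\<close>.\<close>

definition limit_case2 :: "(real^2) set \<Rightarrow> (real^2) set \<Rightarrow> (real^2) set \<Rightarrow> bool" where
  "limit_case2 x y z \<longleftrightarrow> configuration2 x y z \<and> is_center x y z \<and>
     (\<exists>L1 L2. {L. outer_common_tangent x z L} = {L1, L2} \<and>
        card (y \<inter> L1) = 1 \<and> (L1 \<noteq> L2 \<longrightarrow> card (frontier y \<inter> L2) = 2))"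

end

theory Submission
  imports Defs
begin

text \<open>Write \<open>A, B, C, D\<close> for the support functions of the discs on the unit circle. Tightness says that
  the open arcs \<open>A < D\<close>, \<open>B < D\<close>, \<open>C < D\<close> meet pairwise but have no common point. The union of
  \<open>CH(x, y)\<close> and \<open>CH(x, z)\<close> can only be convex if the support of \<open>x\<close> is at least that of \<open>y\<close> and \<open>z\<close> in
  the two directions in which the latter two agree, the normals of their outer common tangents.
  If the center is \<open>a\<close>, this puts both ends of the arc \<open>C < D\<close>
  outside the arc \<open>A < D\<close>, which is then contained in the former and meets \<open>B < D\<close> within it; likewise
  for \<open>c\<close>. If the center is \<open>d\<close>, the same argument excludes that \<open>d\<close> touches both tangents of \<open>a\<close> and
  \<open>c\<close>; and if it exceeded both, the arc \<open>B < D\<close> would avoid the two tangent directions, although it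
  has points on both sides of the chord between them.\<close>

section \<open>Support functions of discs and of their convex hulls\<close>

definition support :: "'a::real_inner \<Rightarrow> real \<Rightarrow> 'a \<Rightarrow> real" where
  "support p r u = u \<bullet> p + r"

lemma cball_inner_le:
  fixes u :: "'a::real_inner"
  assumes "norm u = 1" and "q \<in> cball p r"
  shows "u \<bullet> q \<le> support p r u"
proof -
  have "u \<bullet> (q - p) \<le> norm u * norm (q - p)" by (rule norm_cauchy_schwarz)
  also have "\<dots> \<le> r" using assms by (simp add: dist_norm norm_minus_commute)
  finally show ?thesis by (simp add: support_def inner_diff_right)
qed

text \<open>Equality case of Cauchy-Schwarz: the squared distance from \<open>q\<close> to
  \<open>p + r *\<^sub>R u\<close> is \<open>(norm (q - p))\<^sup>2 - r\<^sup>2\<close>, hence at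
  most 0. So a disc touches its support line in one point only.\<close>

lemma cball_inner_eqD:
  fixes u :: "'a::real_inner"
  assumes "norm u = 1" and "q \<in> cball p r" and "u \<bullet> q = support p r u"
  shows "q = p + r *\<^sub>R u"
proof -
  have n: "norm (q - p) \<le> r" using assms by (simp add: dist_norm norm_minus_commute)
  have r: "0 \<le> r" using n norm_ge_zero[of "q - p"] by linarith
  have i: "u \<bullet> (q - p) = r" using assms by (simp add: support_def inner_diff_right)
  have uu: "u \<bullet> u = 1" using assms by (simp add: dot_square_norm)
  have "(norm (q - p - r *\<^sub>R u))\<^sup>2 = (norm (q - p))\<^sup>2 - 2 * r * (u \<bullet> (q - p)) + r\<^sup>2 * (u \<bullet> u)"
    by (simp only: power2_norm_eq_inner)
       (simp add: inner_diff_left inner_diff_right inner_commute power2_eq_square algebra_simps)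
  also have "\<dots> = (norm (q - p))\<^sup>2 - r\<^sup>2"
    unfolding i uu by (simp add: power2_eq_square)
  also have "\<dots> \<le> 0" using n by (simp add: power_mono)
  finally have "q - p - r *\<^sub>R u = 0" by simp
  then show ?thesis by (simp add: algebra_simps)
qed

lemma cball_touching_point:
  fixes u :: "'a::real_inner"
  assumes "norm u = 1" and "0 \<le> r"
  shows "p + r *\<^sub>R u \<in> cball p r" and "u \<bullet> (p + r *\<^sub>R u) = support p r u"
  using assms by (simp_all add: dist_norm support_def inner_add_right dot_square_norm)

lemma cball_Int_support_line:
  fixes u :: "'a::real_inner"
  assumes "norm u = 1" and "0 \<le> r"
  shows "cball p r \<inter> {w. u \<bullet> w = support p r u} = {p + r *\<^sub>R u}"
  using cball_inner_eqD[OF assms(1)] cball_touching_point[OF assms] by blast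

lemma cball_subset_convex_hull_support_le:
  fixes u :: "'a::euclidean_space"
  assumes "norm u = 1" and "0 \<le> r" and "cball p r \<subseteq> convex hull U"
    and "\<And>q. q \<in> U \<Longrightarrow> u \<bullet> q \<le> t"
  shows "support p r u \<le> t"
proof -
  have "convex hull U \<subseteq> {q. u \<bullet> q \<le> t}"
    by (rule hull_minimal) (use assms(4) convex_halfspace_le in auto)
  then show ?thesis
    using cball_touching_point[OF assms(1,2), of p] assms(3) by (metis mem_Collect_eq subsetD)
qed

text \<open>The hull is compact, so a point of the disc outside it is strictly separated from it;
  the unit normal pointing away from the hull is the required direction.\<close>

lemma not_subset_convex_hull_cballs:
  fixes p :: "'a::euclidean_space"
  assumes "\<not> cball p r \<subseteq> convex hull (cball p1 r1 \<union> cball p2 r2)"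
    and "0 \<le> r1" and "0 \<le> r2"
  obtains u where "norm u = 1" and "support p1 r1 u < support p r u"
    and "support p2 r2 u < support p r u"
proof -
  let ?K = "convex hull (cball p1 r1 \<union> cball p2 r2)"
  obtain q where q: "q \<in> cball p r" "q \<notin> ?K" using assms(1) by blast
  have "closed ?K" by (intro compact_imp_closed compact_convex_hull compact_Un compact_cball)
  from separating_hyperplane_closed_point[OF convex_convex_hull this q(2)]
  obtain a b where ab: "a \<bullet> q < b" "\<And>x. x \<in> ?K \<Longrightarrow> b < a \<bullet> x" by blast
  \<comment> \<open>For \<open>a = 0\<close> a point of the hull would give both
    \<open>0 < b\<close> and \<open>b < 0\<close>.\<close>
  have "p1 \<in> ?K" using assms(2) by (intro hull_inc) auto
  then have a0: "a \<noteq> 0" using ab by fastforce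
  \<comment> \<open>The hull lies on the side of larger \<open>a \<bullet> x\<close>, so the outward
    normal is a multiple of \<open>- a\<close>.\<close>
  define u where "u = - (1 / norm a) *\<^sub>R a"
  have u: "norm u = 1" using a0 by (simp add: u_def)
  have ux: "u \<bullet> x = - (a \<bullet> x) / norm a" for x by (simp add: u_def)
  have sep: "u \<bullet> x < u \<bullet> q" if "x \<in> ?K" for x
    unfolding ux using ab(1) ab(2)[OF that] a0 by (simp add: divide_strict_right_mono)
  have "support p' r' u < u \<bullet> q"
    if "0 \<le> r'" "cball p' r' \<subseteq> cball p1 r1 \<union> cball p2 r2" for p' r'
  proof -
    have "p' + r' *\<^sub>R u \<in> ?K"
      using cball_touching_point(1)[OF u that(1)] that(2) by (meson hull_inc subsetD)
    from sep[OF this] show ?thesis using cball_touching_point(2)[OF u that(1)] by simp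
  qed
  from this[of r1 p1] this[of r2 p2] show ?thesis
    using that[OF u] cball_inner_le[OF u q(1)] assms(2,3) by force
qed

section \<open>Orthonormal frames and chords of the unit circle in the plane\<close>

definition perp :: "real^2 \<Rightarrow> real^2" where
  "perp v = vector [- v$2, v$1]"

lemma inner_2: "v \<bullet> w = v$1 * w$1 + v$2 * w$2" for v w :: "real^2"
  by (simp add: inner_vec_def sum_2)

lemma perp_nth [simp]: "perp v $ 1 = - v$2" "perp v $ 2 = v$1"
  by (simp_all add: perp_def)

lemma perp_orthogonal [simp]: "v \<bullet> perp v = 0" "perp v \<bullet> v = 0"
  by (simp_all add: inner_2)

lemma norm_perp [simp]: "norm (perp v) = norm v"
  by (simp add: norm_eq_sqrt_inner inner_2 algebra_simps)

lemma frame_expansion: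
  assumes "norm u = 1"
  shows "w = (u \<bullet> w) *\<^sub>R u + (perp u \<bullet> w) *\<^sub>R perp u"
    and "(norm w)\<^sup>2 = (u \<bullet> w)\<^sup>2 + (perp u \<bullet> w)\<^sup>2"
proof -
  have e: "u$1 * u$1 + u$2 * u$2 = 1" using assms by (simp add: norm_eq_1 inner_2)
  \<comment> \<open>Multiplying by \<open>u \<bullet> u = 1\<close> turns the claims into polynomial
    identities in the coordinates.\<close>
  have "w$1 = (u$1 * u$1 + u$2 * u$2) * w$1" "w$2 = (u$1 * u$1 + u$2 * u$2) * w$2"
    by (simp_all add: e)
  then show "w = (u \<bullet> w) *\<^sub>R u + (perp u \<bullet> w) *\<^sub>R perp u"
    by (simp add: vec_eq_iff forall_2 inner_2 algebra_simps)
  have "(norm w)\<^sup>2 = (u$1 * u$1 + u$2 * u$2) * (w \<bullet> w)"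
    by (simp add: e power2_norm_eq_inner)
  also have "\<dots> = (u \<bullet> w)\<^sup>2 + (perp u \<bullet> w)\<^sup>2"
    by (simp add: inner_2 power2_eq_square algebra_simps)
  finally show "(norm w)\<^sup>2 = (u \<bullet> w)\<^sup>2 + (perp u \<bullet> w)\<^sup>2" .
qed

text \<open>The determinant of \<open>x\<close> and \<open>y\<close> times either coordinate of
  \<open>n\<close> is 0, so the determinant vanishes.\<close>

lemma orthogonal_imp_parallel:
  fixes n x y :: "real^2"
  assumes "n \<noteq> 0" and "n \<bullet> x = 0" and "n \<bullet> y = 0" and "x \<noteq> 0"
  obtains s where "y = s *\<^sub>R x"
proof -
  have "n$1 * (x$1 * y$2 - x$2 * y$1) = (n \<bullet> x) * y$2 - (n \<bullet> y) * x$2"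
    and "n$2 * (x$1 * y$2 - x$2 * y$1) = (n \<bullet> y) * x$1 - (n \<bullet> x) * y$1"
    by (simp_all add: inner_2 algebra_simps)
  moreover have "n$1 \<noteq> 0 \<or> n$2 \<noteq> 0" using assms(1) by (auto simp: vec_eq_iff forall_2)
  ultimately have c: "x$1 * y$2 = x$2 * y$1" using assms(2,3) by auto
  have "(x \<bullet> x) *\<^sub>R y = (x \<bullet> y) *\<^sub>R x"
    using c by (simp add: vec_eq_iff forall_2 inner_2 algebra_simps)
  moreover have "x \<bullet> x \<noteq> 0" using assms(4) by simp
  ultimately have "y = ((x \<bullet> y) / (x \<bullet> x)) *\<^sub>R x"
    by (metis (no_types, lifting) divide_inverse_commute divideR_right scaleR_scaleR)
  then show ?thesis by (rule that)
qed

text \<open>For the point \<open>w\<close> with parameter \<open>s\<close> on the line through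
  \<open>u1\<close> and \<open>u2\<close>, the square of \<open>norm w\<close> is
  \<open>1 - s * (1 - s) * e\<close>, where \<open>e\<close> is the squared length of the chord.
  Being in the unit disc thus forces \<open>s\<close> into [0,1], and being on the circle forces it
  to be 0 or 1.\<close>

lemma chord_parametrization:
  fixes n :: "real^2"
  assumes "n \<noteq> 0" and "norm u1 = 1" and "norm u2 = 1" and "u1 \<noteq> u2"
    and "n \<bullet> u1 = t" and "n \<bullet> u2 = t" and "n \<bullet> w = t" and "norm w \<le> 1"
  obtains s where "0 \<le> s" and "s \<le> 1" and "w = (1 - s) *\<^sub>R u1 + s *\<^sub>R u2"
    and "norm w = 1 \<Longrightarrow> w = u1 \<or> w = u2"
proof -
  have "n \<bullet> (u2 - u1) = 0" "n \<bullet> (w - u1) = 0" "u2 - u1 \<noteq> 0"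
    using assms by (auto simp: inner_diff_right)
  then obtain s where s: "w - u1 = s *\<^sub>R (u2 - u1)"
    using orthogonal_imp_parallel assms(1) by metis
  define e where "e = (u2 - u1) \<bullet> (u2 - u1)"
  have e: "e > 0" using assms(4) by (simp add: e_def)
  have uu: "u1 \<bullet> u1 = 1" "u2 \<bullet> u2 = 1" using assms by (simp_all add: dot_square_norm)
  have w: "w = (1 - s) *\<^sub>R u1 + s *\<^sub>R u2" using s by (simp add: algebra_simps)
  have e': "e = 2 - 2 * (u1 \<bullet> u2)"
    unfolding e_def using uu by (simp add: inner_diff_left inner_diff_right inner_commute)
  have "(norm w)\<^sup>2 = (1 - s)\<^sup>2 * (u1 \<bullet> u1) + 2 * s * (1 - s) * (u1 \<bullet> u2) + s\<^sup>2 * (u2 \<bullet> u2)"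
    unfolding w power2_norm_eq_inner
    by (simp add: inner_add_left inner_add_right inner_commute power2_eq_square algebra_simps)
  also have "\<dots> = 1 + (s * s - s) * e"
    unfolding uu e' by (simp add: power2_eq_square algebra_simps)
  finally have nw: "(norm w)\<^sup>2 = 1 + (s * s - s) * e" .
  have "(norm w)\<^sup>2 \<le> 1" using assms(8) by (simp add: power_le_one)
  then have "s * (1 - s) \<ge> 0" using nw e by (simp add: mult_le_0_iff algebra_simps)
  then have "0 \<le> s" "s \<le> 1" by (auto simp: zero_le_mult_iff)
  moreover have "w = u1 \<or> w = u2" if "norm w = 1"
  proof -
    have "s * s - s = 0" using nw that e by simp
    then have "s = 0 \<or> s = 1" by (simp add: algebra_simps)
    then show ?thesis using w by auto
  qed
  ultimately show ?thesis using that w by blast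
qed

text \<open>The differences of support functions of discs are the affine functions. If one of them
  vanishes at both ends of a chord of the unit circle and another one is positive on both sides of
  the chord, then the latter is positive at some point of the chord, hence at one of its ends. This
  replaces all reasoning about the cyclic order of arcs.\<close>

lemma positive_at_chord_end:
  fixes p :: "real^2"
  assumes "norm u1 = 1" and "norm u2 = 1" and "u1 \<noteq> u2"
    and "support p r u1 = support q s u1" and "support p r u2 = support q s u2"
    and "norm v = 1" and "norm w = 1"
    and v: "support p r v > support q s v" "support p' r' v > support q' s' v"
    and w: "support p r w \<le> support q s w" "support p' r' w > support q' s' w"
  shows "support p' r' u1 > support q' s' u1 \<or> support p' r' u2 > support q' s' u2"
proof -
  define g where "g u = support p r u - support q s u" for u
  define f where "f u = support p' r' u - support q' s' u" for u
  \<comment> \<open>The weight at which the affine function \<open>g\<close> vanishes between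
    \<open>v\<close> and \<open>w\<close>.\<close>
  define k where "k = g v / (g v - g w)"
  have gv: "g v > 0" "g w \<le> 0" "f v > 0" "f w > 0" using v w by (auto simp: f_def g_def)
  have comb: "g ((1 - k) *\<^sub>R x + k *\<^sub>R y) = (1 - k) * g x + k * g y"
    "f ((1 - k) *\<^sub>R x + k *\<^sub>R y) = (1 - k) * f x + k * f y" for k x y
    by (simp_all add: f_def g_def support_def inner_add_left algebra_simps)
  have k: "0 \<le> k" "k \<le> 1" using gv by (simp_all add: k_def divide_simps)
  define z where "z = (1 - k) *\<^sub>R v + k *\<^sub>R w"
  have "(1 - k) * g v + k * g w = g v - k * (g v - g w)" by (simp add: algebra_simps)
  also have "\<dots> = 0" using gv by (simp add: k_def)
  finally have gz: "g z = 0" unfolding z_def comb .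
  have fz: "f z > 0"
  proof (cases "k = 0")
    case True then show ?thesis using gv by (simp add: z_def)
  next
    case False
    then have "k * f w > 0" "(1 - k) * f v \<ge> 0" using k gv by auto
    then show ?thesis unfolding z_def comb by linarith
  qed
  have "norm z \<le> (1 - k) * norm v + k * norm w"
    unfolding z_def using k by (intro order.trans[OF norm_triangle_ineq]) simp
  then have nz: "norm z \<le> 1" using assms by simp
  have gu: "g u1 = 0" "g u2 = 0" using assms by (simp_all add: g_def)
  \<comment> \<open>The zero set of \<open>g\<close> is a line with normal \<open>p - q\<close>; it
    carries the chord from \<open>u1\<close> to \<open>u2\<close>, and \<open>z\<close> lies on it
    within the unit disc.\<close>
  have gi: "(p - q) \<bullet> x = g x + (s - r)" for x
    by (simp add: g_def support_def inner_diff_left inner_diff_right inner_commute[of _ x])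
  have "p - q \<noteq> 0" using gi[of v] gi[of u1] gu gv by auto
  from chord_parametrization[OF this assms(1-3) _ _ _ nz, of "s - r"]
  obtain l where l: "0 \<le> l" "l \<le> 1" "z = (1 - l) *\<^sub>R u1 + l *\<^sub>R u2"
    using gi gu gz by (metis add_0)
  have "f z = (1 - l) * f u1 + l * f u2" unfolding l(3) comb ..
  then have "f u1 > 0 \<or> f u2 > 0"
    using fz l by (smt (verit) mult_nonneg_nonpos)
  then show ?thesis by (simp add: f_def)
qed

section \<open>Directions in which two support functions agree\<close>

lemma common_tangent_directions:
  fixes p q :: "real^2"
  assumes "\<not> cball p r \<subseteq> cball q s" and "\<not> cball q s \<subseteq> cball p r"
  obtains u1 u2 where "norm u1 = 1" and "norm u2 = 1" and "u1 \<noteq> u2"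
    and "support p r u1 = support q s u1" and "support p r u2 = support q s u2"
    and "\<And>u. norm u = 1 \<Longrightarrow> support p r u = support q s u \<Longrightarrow> u = u1 \<or> u = u2"
proof -
  define n where "n = p - q"
  define e where "e = s - r"
  \<comment> \<open>Agreement in direction \<open>u\<close> means \<open>n \<bullet> u = e\<close>.
    Since neither disc contains the other, this line has distance less than 1 from the origin and
    cuts the unit circle in two points, mirror images in the axis \<open>i\<close>.\<close>
  have "dist p q + r > s" "dist q p + s > r"
    using assms by (simp_all add: cball_subset_cball_iff not_le)
  then have ne: "\<bar>e\<bar> < norm n" by (simp add: n_def e_def dist_norm norm_minus_commute abs_less_iff)
  then have n0: "n \<noteq> 0" by auto
  define i where "i = n /\<^sub>R norm n"
  have i: "norm i = 1" using n0 by (simp add: i_def)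
  define c where "c = e / norm n"
  define d where "d = sqrt (1 - c\<^sup>2)"
  have "\<bar>c\<bar> < 1" using ne n0 by (simp add: c_def)
  then have c2: "c\<^sup>2 < 1" by (simp add: abs_square_less_1)
  then have d: "d > 0" "d\<^sup>2 = 1 - c\<^sup>2" by (simp_all add: d_def)
  define u1 where "u1 = c *\<^sub>R i + d *\<^sub>R perp i"
  define u2 where "u2 = c *\<^sub>R i - d *\<^sub>R perp i"
  have ii: "i \<bullet> i = 1" "perp i \<bullet> perp i = 1" using i by (simp_all add: dot_square_norm)
  have co: "i \<bullet> u1 = c" "i \<bullet> u2 = c" "perp i \<bullet> u1 = d" "perp i \<bullet> u2 = - d"
    by (simp_all add: u1_def u2_def inner_add_right inner_diff_right ii)
  have u: "norm u1 = 1" "norm u2 = 1"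
    using frame_expansion(2)[OF i, of u1] frame_expansion(2)[OF i, of u2] d
    by (simp_all add: co power2_eq_1_iff) (smt (verit) norm_ge_zero)+
  have ne12: "u1 \<noteq> u2" using co d by auto
  have iff: "support p r u = support q s u \<longleftrightarrow> n \<bullet> u = e" for u
    by (auto simp: support_def n_def e_def inner_diff_left inner_diff_right inner_commute[of _ u])
  have ni: "n = norm n *\<^sub>R i" using n0 by (simp add: i_def)
  have "n \<bullet> u1 = norm n * c" "n \<bullet> u2 = norm n * c"
    using co by (metis ni inner_scaleR_left)+
  then have nu: "n \<bullet> u1 = e" "n \<bullet> u2 = e" using n0 by (simp_all add: c_def)
  have "v = u1 \<or> v = u2" if "norm v = 1" "n \<bullet> v = e" for v
    using chord_parametrization[OF n0 u ne12 nu that(2)] that(1) by (metis order_refl)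
  then show ?thesis using that[OF u ne12] nu iff by blast
qed

text \<open>Along the circle the difference of the supports is
  \<open>cos t * A + sin t * B + (r - s)\<close>. Zeros at 0, \<open>t\<close> and
  \<open>- t\<close> annihilate first \<open>B\<close>, then \<open>A\<close>, then the
  constant.\<close>

lemma support_eq_near_imp_eq:
  fixes p :: "real^2"
  assumes "norm v = 1" and "open U" and "v \<in> U"
    and eq: "\<And>u. norm u = 1 \<Longrightarrow> u \<in> U \<Longrightarrow> support p r u = support q s u"
  shows "p = q \<and> r = s"
proof -
  define w where "w t = cos t *\<^sub>R v + sin t *\<^sub>R perp v" for t
  have vv: "v \<bullet> v = 1" "perp v \<bullet> perp v = 1" using assms(1) by (simp_all add: dot_square_norm)
  have nw: "norm (w t) = 1" for t
    by (simp add: w_def norm_eq_1 inner_add_left inner_add_right vv flip: power2_eq_square)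
  have "isCont w 0" unfolding w_def by (intro continuous_intros)
  then have "(w \<longlongrightarrow> v) (at 0)" by (simp add: isCont_def w_def)
  then have "eventually (\<lambda>t. w t \<in> U) (at 0)"
    using assms(2,3) by (rule topological_tendstoD)
  then obtain e where e: "e > 0" "\<And>t. t \<noteq> 0 \<Longrightarrow> \<bar>t\<bar> < e \<Longrightarrow> w t \<in> U"
    by (auto simp: eventually_at dist_real_def)
  \<comment> \<open>The cap 1, being below pi, makes \<open>sin t\<close> positive and
    \<open>cos t\<close> less than 1.\<close>
  define t where "t = min (e / 2) 1"
  have t: "0 < t" "t < e" "t \<le> 1" using e by (auto simp: t_def)
  define A where "A = v \<bullet> (p - q)"
  define B where "B = perp v \<bullet> (p - q)"
  have f: "cos x * A + sin x * B + (r - s) = 0" if "w x \<in> U" for x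
    using eq[OF nw that]
    by (simp add: support_def w_def A_def B_def inner_add_left inner_diff_right algebra_simps)
  have f0: "A + (r - s) = 0" using f[of 0] assms(3) by (simp add: w_def)
  have f1: "cos t * A + sin t * B + (r - s) = 0" using f[of t] e(2)[of t] t by simp
  have f2: "cos t * A - sin t * B + (r - s) = 0" using f[of "- t"] e(2)[of "- t"] t by simp
  have "sin t > 0" using t pi_gt3 by (intro sin_gt_zero) auto
  moreover have "sin t * B = 0" using f1 f2 by linarith
  ultimately have B: "B = 0" by simp
  have "cos t < 1" using cos_monotone_0_pi[of 0 t] t pi_gt3 by simp
  moreover have "cos t * A = A" using f0 f1 \<open>sin t * B = 0\<close> by linarith
  ultimately have "A = 0" by auto
  then have "p - q = 0"
    using frame_expansion(1)[OF assms(1), of "p - q", folded A_def B_def] B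
    by (metis add_0 scaleR_zero_left)
  then show ?thesis using f0 \<open>A = 0\<close> by simp
qed

text \<open>Otherwise the discs \<open>y\<close> and \<open>z\<close> touch a common support line,
  at \<open>P\<close> and \<open>Q\<close>, which the disc \<open>x\<close> does not reach. Each of
  the two hulls meets this line in only one of these points, so their union misses the
  midpoint.\<close>

lemma convex_Un_imp_center_le:
  fixes px :: "'a::euclidean_space"
  assumes "0 \<le> ry" and "0 \<le> rz" and "norm u = 1"
    and ny: "\<not> cball py ry \<subseteq> cball pz rz" and nz: "\<not> cball pz rz \<subseteq> cball py ry"
    and un: "convex hull (cball px rx \<union> cball py ry \<union> cball pz rz)
      \<subseteq> convex hull (cball px rx \<union> cball py ry) \<union> convex hull (cball px rx \<union> cball pz rz)"
    and eq: "support py ry u = support pz rz u"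
  shows "support py ry u \<le> support px rx u"
proof (rule ccontr)
  assume "\<not> support py ry u \<le> support px rx u"
  then have lt: "support px rx u < support py ry u" by simp
  define t where "t = support py ry u"
  define P where "P = py + ry *\<^sub>R u"
  define Q where "Q = pz + rz *\<^sub>R u"
  define M where "M = midpoint P Q"
  have PQ: "P \<in> cball py ry" "Q \<in> cball pz rz" "u \<bullet> P = t" "u \<bullet> Q = t"
    using cball_touching_point[OF assms(3)] assms(1,2) eq by (simp_all add: P_def Q_def t_def)
  have uM: "u \<bullet> M = t" using PQ by (simp add: M_def midpoint_def inner_add_right)
  \<comment> \<open>Equal touching points mean internal tangency, where one disc contains the
    other.\<close>
  have "P \<noteq> Q"
  proof
    assume "P = Q"
    then have "py - pz = (rz - ry) *\<^sub>R u" by (simp add: P_def Q_def algebra_simps)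
    then have "dist py pz = \<bar>rz - ry\<bar>" using assms(3) by (simp add: dist_norm)
    then show False using ny nz
      by (simp add: cball_subset_cball_iff dist_commute) (smt (verit))
  qed
  have face: "M = p + r *\<^sub>R u"
    if "M \<in> convex hull (cball px rx \<union> cball p r)" "support p r u = t" for p r
  proof -
    \<comment> \<open>An open half-space with a single boundary point added is convex. It contains
      both discs, so \<open>M\<close>, which is on the boundary, must be that point.\<close>
    let ?H = "{q. u \<bullet> q < t} \<union> {p + r *\<^sub>R u}"
    have e: "u \<bullet> (p + r *\<^sub>R u) = t"
      using that(2) assms(3) by (simp add: support_def inner_add_right dot_square_norm)
    have "convex ?H"
    proof (rule convexI)
      fix x y :: 'a and k l :: real
      assume H: "x \<in> ?H" "y \<in> ?H" "0 \<le> k" "0 \<le> l" "k + l = 1"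
      show "k *\<^sub>R x + l *\<^sub>R y \<in> ?H"
      proof (cases "k = 0 \<or> l = 0 \<or> x = y")
        case True
        then show ?thesis using H by (auto simp flip: scaleR_add_left)
      next
        case False
        then have kl: "k > 0" "l > 0" using H by auto
        have xy: "u \<bullet> x \<le> t" "u \<bullet> y \<le> t" "u \<bullet> x < t \<or> u \<bullet> y < t" using H e False by auto
        have "k * (u \<bullet> x) + l * (u \<bullet> y) < k * t + l * t"
          using xy kl by (smt (verit) mult_left_mono mult_strict_left_mono)
        also have "\<dots> = t" using H(5) by (metis distrib_right mult_1)
        finally show ?thesis by (simp add: inner_add_right)
      qed
    qed
    moreover have "cball px rx \<union> cball p r \<subseteq> ?H"
    proof
      fix q assume "q \<in> cball px rx \<union> cball p r"
      then show "q \<in> ?H"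
      proof
        assume "q \<in> cball px rx"
        from cball_inner_le[OF assms(3) this] show ?thesis using lt by (simp add: t_def)
      next
        assume "q \<in> cball p r"
        from cball_inner_le[OF assms(3) this] cball_inner_eqD[OF assms(3) this] show ?thesis
          using that(2) by fastforce
      qed
    qed
    ultimately have "convex hull (cball px rx \<union> cball p r) \<subseteq> ?H" by (intro hull_minimal)
    then show ?thesis using that(1) uM by auto
  qed
  have "P \<in> convex hull (cball px rx \<union> cball py ry \<union> cball pz rz)"
    "Q \<in> convex hull (cball px rx \<union> cball py ry \<union> cball pz rz)"
    using PQ by (auto intro: hull_inc)
  then have "closed_segment P Q \<subseteq> convex hull (cball px rx \<union> cball py ry \<union> cball pz rz)"
    by (intro closed_segment_subset convex_convex_hull)
  then have "M \<in> convex hull (cball px rx \<union> cball py ry \<union> cball pz rz)"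
    by (auto simp: M_def)
  then have "M = P \<or> M = Q"
    using face[of py ry] face[of pz rz] un eq by (auto simp: P_def Q_def t_def)
  then show False using \<open>P \<noteq> Q\<close> by (auto simp: M_def)
qed

section \<open>Tangent and secant lines in terms of unit normals\<close>

lemma outer_common_tangent_iff:
  assumes "0 \<le> r" and "0 \<le> s"
  shows "outer_common_tangent (cball p r) (cball q s) L \<longleftrightarrow>
    (\<exists>u. norm u = 1 \<and> support p r u = support q s u \<and> L = {w. u \<bullet> w = support p r u})"
    (is "?l \<longleftrightarrow> ?r")
proof
  assume ?l
  then obtain n t where n: "n \<noteq> 0" "L = {w. n \<bullet> w = t}"
    "cball p r \<union> cball q s \<subseteq> {w. n \<bullet> w \<le> t}"
    and c: "card (cball p r \<inter> L) = 1" "card (cball q s \<inter> L) = 1"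
    by (auto simp: outer_common_tangent_def)
  define u where "u = n /\<^sub>R norm n"
  have u: "norm u = 1" using n by (simp add: u_def)
  have un: "u \<bullet> w = n \<bullet> w / norm n" for w by (simp add: u_def divide_inverse_commute)
  have L: "L = {w. u \<bullet> w = t / norm n}" unfolding n(2) un using n(1) by auto
  \<comment> \<open>The half-plane bounds the support from above, a common point with
    \<open>L\<close> from below.\<close>
  have "support p' r' u = t / norm n"
    if "0 \<le> r'" "cball p' r' \<subseteq> cball p r \<union> cball q s"
      and card1: "card (cball p' r' \<inter> L) = 1" for p' r'
  proof (rule antisym)
    have "p' + r' *\<^sub>R u \<in> {w. n \<bullet> w \<le> t}"
      using cball_touching_point(1)[OF u that(1)] that(2) n(3) by blast
    then have "u \<bullet> (p' + r' *\<^sub>R u) \<le> t / norm n"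
      unfolding un by (simp add: divide_right_mono)
    then show "support p' r' u \<le> t / norm n"
      using cball_touching_point(2)[OF u that(1)] by metis
    obtain w where "w \<in> cball p' r'" "w \<in> L"
      by (metis card1 IntD1 IntD2 card_1_singletonE singletonI)
    then show "t / norm n \<le> support p' r' u"
      using cball_inner_le[OF u] L by fastforce
  qed
  from this[of r p] this[of s q] show ?r using u L assms c by auto
next
  assume ?r
  then obtain u where u: "norm u = 1" "support p r u = support q s u"
    "L = {w. u \<bullet> w = support p r u}" by blast
  have "cball p r \<inter> L = {p + r *\<^sub>R u}"
    unfolding u(3) by (rule cball_Int_support_line[OF u(1) assms(1)])
  moreover have "cball q s \<inter> L = {q + s *\<^sub>R u}"
    unfolding u(3,2) by (rule cball_Int_support_line[OF u(1) assms(2)])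
  moreover have "cball p r \<union> cball q s \<subseteq> {w. u \<bullet> w \<le> support p r u}"
    using cball_inner_le[OF u(1)] u(2) by fastforce
  moreover have "u \<noteq> 0" using u(1) by auto
  ultimately show ?l unfolding outer_common_tangent_def using u(3) by auto
qed

lemma card_sphere_Int_line:
  fixes u :: "real^2"
  assumes "norm u = 1" and "\<bar>t - u \<bullet> p\<bar> < r"
  shows "card (sphere p r \<inter> {w. u \<bullet> w = t}) = 2"
proof -
  \<comment> \<open>The signed distance of the line from the centre; \<open>y\<close> will be half
    the length of the chord cut out.\<close>
  define x where "x = t - u \<bullet> p"
  define y where "y = sqrt (r\<^sup>2 - x\<^sup>2)"
  have r: "0 < r" using assms(2) by linarith
  have "x\<^sup>2 < r\<^sup>2" using assms(2) r
    by (metis abs_of_pos power2_abs x_def power_strict_mono abs_ge_zero zero_less_numeral)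
  then have y: "0 < y" "y\<^sup>2 = r\<^sup>2 - x\<^sup>2" by (simp_all add: y_def)
  have uu: "u \<bullet> u = 1" "perp u \<bullet> perp u = 1" using assms(1) by (simp_all add: dot_square_norm)
  define w1 where "w1 = p + x *\<^sub>R u + y *\<^sub>R perp u"
  define w2 where "w2 = p + x *\<^sub>R u + (- y) *\<^sub>R perp u"
  have on: "p + x *\<^sub>R u + z *\<^sub>R perp u \<in> sphere p r \<inter> {w. u \<bullet> w = t}" if "z\<^sup>2 = y\<^sup>2" for z
  proof -
    have "(norm (x *\<^sub>R u + z *\<^sub>R perp u))\<^sup>2 = r\<^sup>2"
      using frame_expansion(2)[OF assms(1), of "x *\<^sub>R u + z *\<^sub>R perp u"] that y
      by (simp add: inner_add_right uu)
    then have "norm (x *\<^sub>R u + z *\<^sub>R perp u) = r" using r by (simp add: power2_eq_iff_nonneg)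
    then have "dist p (p + x *\<^sub>R u + z *\<^sub>R perp u) = r"
      by (metis add.assoc add_diff_cancel_left' dist_commute dist_norm)
    then show ?thesis using uu by (simp add: inner_add_right x_def)
  qed
  have "w = w1 \<or> w = w2" if w: "w \<in> sphere p r" "u \<bullet> w = t" for w
  proof -
    have ux: "u \<bullet> (w - p) = x" using w by (simp add: x_def inner_diff_right)
    have "(norm (w - p))\<^sup>2 = r\<^sup>2" using w by (simp add: dist_norm norm_minus_commute)
    then have "(perp u \<bullet> (w - p))\<^sup>2 = y\<^sup>2"
      using frame_expansion(2)[OF assms(1), of "w - p"] y ux by simp
    then have "perp u \<bullet> (w - p) = y \<or> perp u \<bullet> (w - p) = - y" by (simp add: power2_eq_iff)
    moreover have "w = p + x *\<^sub>R u + (perp u \<bullet> (w - p)) *\<^sub>R perp u"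
      using frame_expansion(1)[OF assms(1), of "w - p"] unfolding ux by (simp add: algebra_simps)
    ultimately show ?thesis unfolding w1_def w2_def by metis
  qed
  then have "sphere p r \<inter> {w. u \<bullet> w = t} = {w1, w2}"
    using on[of y, folded w1_def] on[of "- y", folded w2_def] by (auto simp del: mem_sphere)
  moreover have "w1 \<noteq> w2"
  proof
    assume "w1 = w2"
    then have "perp u \<bullet> w1 = perp u \<bullet> w2" by simp
    then show False using y(1) uu by (simp add: w1_def w2_def inner_add_right inner_diff_right)
  qed
  ultimately show ?thesis by simp
qed

section \<open>Tight implications in terms of support functions\<close>

lemma support_le_of_subset_CH:
  assumes "norm u = 1" and "0 \<le> r" and "cball p r \<subseteq> CH {cball p1 r1, cball p2 r2}"
  shows "support p r u \<le> max (support p1 r1 u) (support p2 r2 u)"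
  using assms(3) unfolding CH_def
  by (rule cball_subset_convex_hull_support_le[OF assms(1,2)])
     (use cball_inner_le[OF assms(1)] in \<open>fastforce simp: le_max_iff_disj\<close>)

text \<open>\<open>support_le\<close> expresses the implication, \<open>above_ab\<close>,
  \<open>above_ac\<close> and \<open>above_bc\<close> its failure without \<open>c\<close>,
  \<open>b\<close> and \<open>a\<close>. The assumptions are symmetric in \<open>a\<close> and
  \<open>c\<close>, so by \<open>swap\<close> every fact about \<open>a\<close> has a counterpart
  for \<open>c\<close>.\<close>

locale tight_discs =
  fixes pa pb pc pd :: "real^2" and ra rb rc rd :: real
  assumes radius_nonneg: "0 \<le> ra" "0 \<le> rb" "0 \<le> rc" "0 \<le> rd"
    and support_le: "\<And>u. norm u = 1 \<Longrightarrow>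
      support pd rd u \<le> support pa ra u \<or> support pd rd u \<le> support pb rb u \<or>
      support pd rd u \<le> support pc rc u"
    and above_ab: "\<exists>u. norm u = 1 \<and> support pa ra u < support pd rd u \<and>
      support pb rb u < support pd rd u"
    and above_ac: "\<exists>u. norm u = 1 \<and> support pa ra u < support pd rd u \<and>
      support pc rc u < support pd rd u"
    and above_bc: "\<exists>u. norm u = 1 \<and> support pb rb u < support pd rd u \<and>
      support pc rc u < support pd rd u"
begin

abbreviation "A \<equiv> support pa ra"
abbreviation "B \<equiv> support pb rb"
abbreviation "C \<equiv> support pc rc"
abbreviation "D \<equiv> support pd rd"

lemma swap: "tight_discs pc pb pa pd rc rb ra rd"
  using radius_nonneg support_le above_ab above_ac above_bc
  by unfold_locales blast+

text \<open>The anti-exchange property: otherwise the support functions of \<open>a\<close> and \<open>d\<close> agree on the open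
  arc on which \<open>d\<close> exceeds \<open>b\<close> and \<open>c\<close>, and then \<open>a = d\<close>.\<close>

lemma anti_exchange:
  "\<exists>u. norm u = 1 \<and> C u < A u \<and> D u < A u"
proof (rule ccontr)
  assume "\<not> ?thesis"
  then have le: "A u \<le> C u \<or> A u \<le> D u" if "norm u = 1" for u
    using that not_le by blast
  obtain v where v: "norm v = 1" "B v < D v" "C v < D v" using above_bc by blast
  let ?U = "{u. B u < D u} \<inter> {u. C u < D u}"
  have "open ?U" unfolding support_def
    by (intro open_Int open_Collect_less continuous_intros)
  \<comment> \<open>Here \<open>d\<close> exceeds \<open>b\<close> and \<open>c\<close>, so
    \<open>support_le\<close> yields \<open>D u \<le> A u\<close>, and then \<open>le\<close> the
    converse.\<close>
  moreover have "A u = D u" if "norm u = 1" "u \<in> ?U" for u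
    using le[OF that(1)] support_le[OF that(1)] that(2) by auto
  ultimately have "pa = pd \<and> ra = rd" using v by (intro support_eq_near_imp_eq) auto
  then show False using above_ab by auto
qed

lemma not_subset_CH: "\<not> cball pa ra \<subseteq> CH {cball pc rc, cball pd rd}"
proof
  assume sub: "cball pa ra \<subseteq> CH {cball pc rc, cball pd rd}"
  obtain u where u: "norm u = 1" "C u < A u" "D u < A u" using anti_exchange by blast
  from support_le_of_subset_CH[OF u(1) radius_nonneg(1) sub] u show False by simp
qed

text \<open>\<open>D - C\<close> vanishes at the chord ends, is positive at a witness of
  \<open>above_ac\<close> and, by \<open>support_le\<close>, not at one of \<open>above_ab\<close>.
  As \<open>D - A\<close> is positive at both witnesses, it is positive at a chord end.\<close>

lemma center_not_a:
  assumes "norm u1 = 1" and "norm u2 = 1" and "u1 \<noteq> u2"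
    and "C u1 = D u1" and "C u2 = D u2"
  shows "A u1 < D u1 \<or> A u2 < D u2"
proof -
  obtain v where v: "norm v = 1" "A v < D v" "C v < D v" using above_ac by blast
  obtain w where w: "norm w = 1" "A w < D w" "B w < D w" using above_ab by blast
  have "D w \<le> C w" using support_le[OF w(1)] w by auto
  from positive_at_chord_end[OF assms(1-3) assms(4,5)[symmetric] v(1) w(1) v(3,2) this w(2)]
  show ?thesis by simp
qed

text \<open>If \<open>d\<close> exceeded both tangents, \<open>B < D\<close> would hold at a chord
  end, where also \<open>A = C < D\<close>, against \<open>support_le\<close>. If it touched both,
  \<open>center_not_a\<close> would apply to the same two directions.\<close>

lemma center_d_touches_one:
  assumes "norm u1 = 1" and "norm u2 = 1" and "u1 \<noteq> u2"
    and "A u1 = C u1" and "A u2 = C u2" and "A u1 \<le> D u1" and "A u2 \<le> D u2"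
  shows "(A u1 = D u1 \<and> A u2 < D u2) \<or> (A u2 = D u2 \<and> A u1 < D u1)"
proof -
  have "A u1 = D u1 \<or> A u2 = D u2"
  proof (rule ccontr)
    assume "\<not> ?thesis"
    then have lt: "A u1 < D u1" "A u2 < D u2" using assms by auto
    obtain v where v: "norm v = 1" "A v < D v" "B v < D v" using above_ab by blast
    obtain w where w: "norm w = 1" "B w < D w" "C w < D w" using above_bc by blast
    have "A v < C v" "C w \<le> A w"
      using support_le[OF v(1)] support_le[OF w(1)] v w by auto
    from positive_at_chord_end[OF assms(1-3) assms(4,5)[symmetric] v(1) w(1) this(1) v(3) this(2) w(2)]
    have "B u1 < D u1 \<or> B u2 < D u2" .
    then show False
      using support_le[OF assms(1)] support_le[OF assms(2)] lt assms(4,5) by auto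
  qed
  moreover have "\<not> (A u1 = D u1 \<and> A u2 = D u2)"
    using center_not_a[OF assms(1-3)] assms(4,5) by auto
  ultimately show ?thesis using assms(6,7) by auto
qed

text \<open>If \<open>d\<close> touched the first tangent and lay beyond the second one, then the point \<open>o\<close> common to
  both tangents would lie between the points where \<open>a\<close> and \<open>d\<close> touch the first one. As \<open>c\<close> arises from
  \<open>a\<close> by shrinking towards \<open>o\<close>, this would give \<open>c \<subseteq> CH(a, d)\<close>.\<close>

lemma not_beyond_larger:
  assumes "norm u1 = 1" and "norm u2 = 1" and "u1 \<noteq> u2"
    and "A u1 = C u1" and "A u2 = C u2" and "A u1 = D u1" and "rc < ra"
  shows "u2 \<bullet> pd - rd < A u2"
proof (rule ccontr)
  assume "\<not> ?thesis"
  then have beyond: "A u2 \<le> u2 \<bullet> pd - rd" by simp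
  define P where "P = pa + ra *\<^sub>R u1"
  define Q where "Q = pd + rd *\<^sub>R u1"
  have P: "P \<in> cball pa ra" "u1 \<bullet> P = A u1" and Q: "Q \<in> cball pd rd" "u1 \<bullet> Q = A u1"
    using cball_touching_point[OF assms(1)] radius_nonneg assms(6) by (simp_all add: P_def Q_def)
  have "norm (- u2) = 1" using assms(2) by simp
  from cball_inner_le[OF this Q(1)] have "A u2 \<le> u2 \<bullet> Q"
    using beyond by (simp add: support_def)
  moreover have "u2 \<bullet> P \<le> A u2" by (rule cball_inner_le[OF assms(2) P(1)])
  moreover have "connected (closed_segment P Q)" by simp
  \<comment> \<open>On the first tangent, \<open>P\<close> is not beyond the second one while
    \<open>Q\<close> is not before it, so the segment meets it.\<close>
  ultimately obtain X where X: "X \<in> closed_segment P Q" "u2 \<bullet> X = A u2"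
    using connected_ivt_hyperplane[of "closed_segment P Q" P Q u2 "A u2"] by auto
  then obtain l where l: "0 \<le> l" "l \<le> 1" "X = (1 - l) *\<^sub>R P + l *\<^sub>R Q"
    by (auto simp: in_segment)
  have X1: "u1 \<bullet> X = A u1" using P Q by (simp add: l inner_add_right algebra_simps)
  \<comment> \<open>The centre of the homothety with ratio \<open>rc / ra\<close> that maps
    \<open>a\<close> to \<open>c\<close>; both outer tangents pass through it.\<close>
  define apex where "apex = (1 / (ra - rc)) *\<^sub>R (ra *\<^sub>R pc - rc *\<^sub>R pa)"
  have apex: "u \<bullet> apex = A u" if "A u = C u" for u
  proof -
    have e: "u \<bullet> pc = u \<bullet> pa + (ra - rc)" using that by (simp add: support_def)
    then have "u \<bullet> (ra *\<^sub>R pc - rc *\<^sub>R pa) = (ra - rc) * A u"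
      by (simp add: support_def inner_diff_right e) (simp add: algebra_simps)
    then show ?thesis using assms(7) by (simp add: apex_def)
  qed
  \<comment> \<open>Both points lie on both tangents. If they differed, the normals would be
    opposite, and adding the two equations \<open>A = C\<close> would give equal radii.\<close>
  have "X = apex"
  proof (rule ccontr)
    assume "X \<noteq> apex"
    then have n0: "X - apex \<noteq> 0" by simp
    have ort: "(X - apex) \<bullet> u1 = 0" "(X - apex) \<bullet> u2 = 0"
      using X(2) X1 apex[OF assms(4)] apex[OF assms(5)]
      by (simp_all add: inner_commute[of "X - apex"] inner_diff_right)
    obtain k where k: "u2 = k *\<^sub>R u1"
      using orthogonal_imp_parallel[OF n0 ort] assms(1) by (metis norm_zero zero_neq_one)
    then have "\<bar>k\<bar> = 1" using assms(1,2) by simp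
    then have "u2 = - u1" using k assms(3) by (auto simp: abs_if split: if_splits)
    then show False using assms(4,5,7) by (simp add: support_def)
  qed
  \<comment> \<open>This is \<open>c \<subseteq> CH(a, d)\<close> read on support functions:
    \<open>ra * C u\<close> is \<open>(ra - rc) * (u \<bullet> apex) + rc * A u\<close>, and
    \<open>apex\<close> lies between \<open>P\<close> in \<open>a\<close> and \<open>Q\<close> in
    \<open>d\<close>.\<close>
  have "C u \<le> A u \<or> C u \<le> D u" if u: "norm u = 1" for u
  proof (rule ccontr)
    assume "\<not> ?thesis"
    then have lt: "A u < C u" "D u < C u" by auto
    have "u \<bullet> P \<le> A u" "u \<bullet> Q \<le> D u" using cball_inner_le[OF u] P Q by auto
    then have "u \<bullet> P < C u" "u \<bullet> Q < C u" using lt by auto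
    moreover have "u \<bullet> apex = (1 - l) * (u \<bullet> P) + l * (u \<bullet> Q)"
      unfolding \<open>X = apex\<close>[symmetric] l(3) by (simp add: inner_add_right)
    ultimately have "u \<bullet> apex < C u"
      using l convex_bound_lt[of "u \<bullet> P" "C u" "u \<bullet> Q" "1 - l" l] by simp
    then have "(ra - rc) * (u \<bullet> apex) < (ra - rc) * C u" using assms(7) by simp
    moreover have "(ra - rc) * (u \<bullet> apex) = ra * (u \<bullet> pc) - rc * (u \<bullet> pa)"
      using assms(7) by (simp add: apex_def inner_diff_right)
    ultimately have "rc * C u < rc * A u" by (simp add: support_def algebra_simps)
    then show False using lt(1) radius_nonneg(3) by (simp add: mult_less_cancel_left)
  qed
  then show False using tight_discs.anti_exchange[OF swap] by (meson not_le)
qed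

text \<open>With equal radii there is no apex: the tangents are parallel with opposite normals, at
  distance \<open>2 * ra\<close>, which is positive because the lines differ. Then \<open>d\<close>,
  touching the first tangent from inside, has points before the second.\<close>

lemma not_beyond:
  assumes "norm u1 = 1" and "norm u2 = 1" and "u1 \<noteq> u2"
    and "A u1 = C u1" and "A u2 = C u2" and "A u1 = D u1"
    and ne: "{w. u1 \<bullet> w = A u1} \<noteq> {w. u2 \<bullet> w = A u2}"
  shows "u2 \<bullet> pd - rd < A u2"
proof (cases ra rc rule: linorder_cases)
  case greater
  then show ?thesis using not_beyond_larger assms by blast
next
  case less
  then show ?thesis
    using tight_discs.not_beyond_larger[OF swap assms(1-3)] assms(4-6) by simp
next
  case equal
  have n0: "pa - pc \<noteq> 0" using anti_exchange equal by auto
  have ort: "(pa - pc) \<bullet> u1 = 0" "(pa - pc) \<bullet> u2 = 0"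
    using assms(4,5) equal
    by (simp_all add: support_def inner_diff_left inner_commute[of pa] inner_commute[of pc])
  obtain k where k: "u2 = k *\<^sub>R u1"
    using orthogonal_imp_parallel[OF n0 ort] assms(1) by (metis norm_zero zero_neq_one)
  then have "\<bar>k\<bar> = 1" using assms(1,2) by simp
  then have u2: "u2 = - u1" using k assms(3) by (auto simp: abs_if split: if_splits)
  have "ra \<noteq> 0"
  proof
    assume "ra = 0"
    then have "A u2 = - A u1" by (simp add: support_def u2)
    then show False using ne u2 by auto
  qed
  then show ?thesis using assms(6) radius_nonneg(1) by (simp add: support_def u2)
qed

end

section \<open>Translating configurations and tightness into support functions\<close>

lemma subset_CH: "x \<in> Y \<Longrightarrow> x \<subseteq> CH Y"
  unfolding CH_def by (meson Union_upper hull_subset order_trans)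

lemma relabeling_cases:
  assumes "distinct [a, b, c]" and "{x, y, z} = {a, b, c}"
  shows "(x = a \<and> {y, z} = {b, c}) \<or> (x = b \<and> {y, z} = {a, c}) \<or> (x = c \<and> {y, z} = {a, b})"
proof -
  have "x \<in> {a, b, c}" "y \<in> {a, b, c}" "z \<in> {a, b, c}"
    "a \<in> {x, y, z}" "b \<in> {x, y, z}" "c \<in> {x, y, z}"
    using assms(2) by blast+
  then show ?thesis using assms(1) by auto
qed

lemma incomparable_not_configuration1I:
  assumes "is_circle x" and "is_circle y" and "is_circle z"
    and "\<not> x \<subseteq> CH {y, z}" and "\<not> y \<subseteq> CH {x, z}" and "\<not> z \<subseteq> CH {x, y}"
  shows "incomparable_circles x y z" and "\<not> configuration1 x y z"
proof -
  have sub: "u \<subseteq> CH {v, w}" "u \<subseteq> CH {w, v}" if "u \<subseteq> v" for u v w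
    using that subset_CH[of v "{v, w}"] subset_CH[of v "{w, v}"] by auto
  have n: "\<not> x \<subseteq> y" "\<not> x \<subseteq> z" "\<not> y \<subseteq> x" "\<not> y \<subseteq> z" "\<not> z \<subseteq> x" "\<not> z \<subseteq> y"
    using assms(4-6) sub by blast+
  then have d: "distinct [x, y, z]" by auto
  show "incomparable_circles x y z"
    unfolding incomparable_circles_def pairwise_def using assms(1-3) n d by auto
  show "\<not> configuration1 x y z"
  proof
    assume "configuration1 x y z"
    then obtain u v w where "{u, v, w} = {x, y, z}" "CH {u, v, w} = CH {v, w}"
      by (auto simp: configuration1_def)
    moreover have "u \<subseteq> CH {u, v, w}" by (rule subset_CH) simp
    ultimately show False using relabeling_cases[OF d, of u v w] assms(4-6) by auto
  qed
qed

lemma CH_Un_imp_center_le: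
  assumes "0 \<le> ry" and "0 \<le> rz" and "norm u = 1"
    and "\<not> cball py ry \<subseteq> cball pz rz" and "\<not> cball pz rz \<subseteq> cball py ry"
    and eq: "CH {cball px rx, cball py ry, cball pz rz} =
      CH {cball px rx, cball py ry} \<union> CH {cball px rx, cball pz rz}"
    and "support py ry u = support pz rz u"
  shows "support py ry u \<le> support px rx u"
  using assms(1-5) _ assms(7)
proof (rule convex_Un_imp_center_le)
  show "convex hull (cball px rx \<union> cball py ry \<union> cball pz rz)
    \<subseteq> convex hull (cball px rx \<union> cball py ry) \<union> convex hull (cball px rx \<union> cball pz rz)"
    using eq by (simp add: CH_def Un_assoc)
qed

lemma tight_implication_imp_tight_discs:
  assumes "tight_implication {cball pa ra, cball pb rb, cball pc rc} (cball pd rd)"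
    and "distinct [cball pa ra, cball pb rb, cball pc rc]"
    and nonneg: "0 \<le> ra" "0 \<le> rb" "0 \<le> rc" "0 \<le> rd"
  shows "tight_discs pa pb pc pd ra rb rc rd"
proof
  let ?a = "cball pa ra" and ?b = "cball pb rb" and ?c = "cball pc rc" and ?d = "cball pd rd"
  have sub: "?d \<subseteq> convex hull (?a \<union> ?b \<union> ?c)"
    using assms(1) by (simp add: tight_implication_def implication_def CH_def Un_assoc)
  have "\<not> ?d \<subseteq> CH ({?a, ?b, ?c} - {?a})" "\<not> ?d \<subseteq> CH ({?a, ?b, ?c} - {?b})"
    "\<not> ?d \<subseteq> CH ({?a, ?b, ?c} - {?c})"
    using assms(1) unfolding tight_implication_def by blast+
  moreover have "{?a, ?b, ?c} - {?a} = {?b, ?c}" "{?a, ?b, ?c} - {?b} = {?a, ?c}"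
    "{?a, ?b, ?c} - {?c} = {?a, ?b}"
    using assms(2) by auto
  ultimately have n: "\<not> ?d \<subseteq> convex hull (?a \<union> ?b)" "\<not> ?d \<subseteq> convex hull (?a \<union> ?c)"
    "\<not> ?d \<subseteq> convex hull (?b \<union> ?c)"
    by (simp_all add: CH_def)
  show "\<exists>u. norm u = 1 \<and> support pa ra u < support pd rd u \<and> support pb rb u < support pd rd u"
    using not_subset_convex_hull_cballs[OF n(1) nonneg(1,2)] by blast
  show "\<exists>u. norm u = 1 \<and> support pa ra u < support pd rd u \<and> support pc rc u < support pd rd u"
    using not_subset_convex_hull_cballs[OF n(2) nonneg(1,3)] by blast
  show "\<exists>u. norm u = 1 \<and> support pb rb u < support pd rd u \<and> support pc rc u < support pd rd u"
    using not_subset_convex_hull_cballs[OF n(3) nonneg(2,3)] by blast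
  fix u :: "real^2"
  assume u: "norm u = 1"
  have "support pd rd u \<le> max (support pa ra u) (max (support pb rb u) (support pc rc u))"
    by (rule cball_subset_convex_hull_support_le[OF u nonneg(4) sub])
       (use cball_inner_le[OF u] in \<open>fastforce simp: le_max_iff_disj\<close>)
  then show "support pd rd u \<le> support pa ra u \<or> support pd rd u \<le> support pb rb u \<or>
    support pd rd u \<le> support pc rc u"
    by (simp add: le_max_iff_disj)
qed (use nonneg in auto)

theorem theorem4p11:
  fixes a b c d :: "(real^2) set"
  assumes "is_circle a" and "is_circle b" and "is_circle c" and "is_circle d"
    and "distinct [a, b, c]"
    and "tight_implication {a, b, c} d"
  shows "configuration3 a c d \<or> limit_case2 a d c"
proof -
  obtain pa ra where a: "a = cball pa ra" "0 \<le> ra" using assms(1) by (auto simp: is_circle_def)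
  obtain pb rb where b: "b = cball pb rb" "0 \<le> rb" using assms(2) by (auto simp: is_circle_def)
  obtain pc rc where c: "c = cball pc rc" "0 \<le> rc" using assms(3) by (auto simp: is_circle_def)
  obtain pd rd where d: "d = cball pd rd" "0 \<le> rd" using assms(4) by (auto simp: is_circle_def)
  interpret tight_discs pa pb pc pd ra rb rc rd
    using tight_implication_imp_tight_discs assms(5,6) a b c d by blast
  interpret sw: tight_discs pc pb pa pd rc rb ra rd by (rule swap)
  have n: "\<not> a \<subseteq> CH {c, d}" "\<not> c \<subseteq> CH {a, d}"
    using not_subset_CH sw.not_subset_CH a c d by auto
  have nd: "\<not> d \<subseteq> CH {a, c}"
  proof
    assume sub: "d \<subseteq> CH {a, c}"
    obtain u where u: "norm u = 1" "A u < D u" "C u < D u" using above_ac by blast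
    from support_le_of_subset_CH[OF u(1) d(2)] sub u show False by (force simp: a c d)
  qed
  have inc: "incomparable_circles a c d" "incomparable_circles a d c" "\<not> configuration1 a d c"
    using incomparable_not_configuration1I n nd assms(1,3,4) by (simp_all add: insert_commute)
  then have dist: "distinct [a, c, d]"
    and pw: "\<not> a \<subseteq> c" "\<not> a \<subseteq> d" "\<not> c \<subseteq> a" "\<not> c \<subseteq> d" "\<not> d \<subseteq> a" "\<not> d \<subseteq> c"
    by (auto simp: incomparable_circles_def pairwise_def)
  \<comment> \<open>In the two directions where \<open>c\<close> and \<open>d\<close> agree,
    convexity of the union would give \<open>D \<le> A\<close>, against
    \<open>center_not_a\<close>.\<close>
  have no_a: False if "CH {a, c, d} = CH {a, c} \<union> CH {a, d}"
  proof -
    from common_tangent_directions[OF pw(4,6)[unfolded c d]]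
    obtain u1 u2 where u: "norm u1 = 1" "norm u2 = 1" "u1 \<noteq> u2" "C u1 = D u1" "C u2 = D u2"
      by metis
    from CH_Un_imp_center_le[OF c(2) d(2) _ pw(4,6)[unfolded c d] that[unfolded a c d]]
    have "C u1 \<le> A u1" "C u2 \<le> A u2" using u by auto
    then show False using center_not_a[OF u] u(4,5) by auto
  qed
  have no_c: False if "CH {c, a, d} = CH {c, a} \<union> CH {c, d}"
  proof -
    from common_tangent_directions[OF pw(2,5)[unfolded a d]]
    obtain u1 u2 where u: "norm u1 = 1" "norm u2 = 1" "u1 \<noteq> u2" "A u1 = D u1" "A u2 = D u2"
      by metis
    from CH_Un_imp_center_le[OF a(2) d(2) _ pw(2,5)[unfolded a d] that[unfolded a c d]]
    have "A u1 \<le> C u1" "A u2 \<le> C u2" using u by auto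
    then show False using sw.center_not_a[OF u] u(4,5) by auto
  qed
  show ?thesis
  proof (cases "configuration3 a c d")
    case False
    then obtain x y z where xyz: "{x, y, z} = {a, c, d}" "CH {x, y, z} = CH {x, y} \<union> CH {x, z}"
      using inc by (auto simp: configuration3_def)
    have eq: "CH {p, q, r} = CH {p, q} \<union> CH {p, r}" if "x = p \<and> {y, z} = {q, r}" for p q r
    proof -
      have "(y = q \<and> z = r) \<or> (y = r \<and> z = q)" using that by (simp add: doubleton_eq_iff)
      then show ?thesis
        using xyz(2) that by (elim disjE) (simp_all add: insert_commute Un_commute)
    qed
    have un: "CH {d, a, c} = CH {d, a} \<union> CH {d, c}"
      using relabeling_cases[OF dist xyz(1)] eq no_a no_c by metis
    then have un': "CH {a, d, c} = CH {a, d} \<union> CH {d, c}" by (simp add: insert_commute)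
    have c2: "configuration2 a d c" using inc un' by (auto simp: configuration2_def)
    have cen: "is_center a d c" using c2 un' by (simp add: is_center_def)
    define L where "L u = {w. u \<bullet> w = A u}" for u
    \<comment> \<open>Either tangent may be the touched one, hence the general \<open>u1\<close>,
      \<open>u2\<close>. By \<open>A u2 < D u2\<close> and \<open>not_beyond\<close>, the centre of
      \<open>d\<close> has distance less than \<open>rd\<close> from \<open>L u2\<close>.\<close>
    have cross: "card (d \<inter> L u1) = 1 \<and> (L u1 \<noteq> L u2 \<longrightarrow> card (frontier d \<inter> L u2) = 2)"
      if "norm u1 = 1" "norm u2 = 1" "u1 \<noteq> u2" "A u1 = C u1" "A u2 = C u2" "A u1 = D u1"
        "A u2 < D u2" for u1 u2
    proof -
      have "card (d \<inter> L u1) = 1"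
        using cball_Int_support_line[OF that(1) d(2)] that(6) by (simp add: L_def d)
      moreover have "L u1 \<noteq> L u2 \<longrightarrow> card (frontier d \<inter> L u2) = 2"
      proof
        assume ne: "L u1 \<noteq> L u2"
        have "u2 \<bullet> pd - rd < A u2"
          by (rule not_beyond[OF that(1-6) ne[unfolded L_def]])
        moreover have "A u2 < u2 \<bullet> pd + rd" using \<open>A u2 < D u2\<close> by (simp add: support_def)
        ultimately have "\<bar>A u2 - u2 \<bullet> pd\<bar> < rd" by linarith
        from card_sphere_Int_line[OF \<open>norm u2 = 1\<close> this] show "card (frontier d \<inter> L u2) = 2"
          by (simp add: L_def d)
      qed
      ultimately show ?thesis ..
    qed
    obtain u1 u2 where u: "norm u1 = 1" "norm u2 = 1" "u1 \<noteq> u2" "A u1 = C u1" "A u2 = C u2"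
      and uniq: "\<And>u. norm u = 1 \<Longrightarrow> A u = C u \<Longrightarrow> u = u1 \<or> u = u2"
      by (rule common_tangent_directions[OF pw(1,3)[unfolded a c]]) blast
    \<comment> \<open>If \<open>a\<close> and \<open>c\<close> are points, the two normals are
      opposite and \<open>L u1 = L u2\<close>.\<close>
    have tangents: "{l. outer_common_tangent a c l} = {L u1, L u2}"
    proof (rule set_eqI)
      fix l
      have "outer_common_tangent a c l \<longleftrightarrow> (\<exists>u. norm u = 1 \<and> A u = C u \<and> l = L u)"
        unfolding a c L_def by (rule outer_common_tangent_iff[OF a(2) c(2)])
      also have "\<dots> \<longleftrightarrow> l = L u1 \<or> l = L u2" using u uniq by blast
      finally show "l \<in> {l. outer_common_tangent a c l} \<longleftrightarrow> l \<in> {L u1, L u2}" by simp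
    qed
    from CH_Un_imp_center_le[OF a(2) c(2) _ pw(1,3)[unfolded a c] un[unfolded a c d]]
    have "A u1 \<le> D u1" "A u2 \<le> D u2" using u by auto
    from center_d_touches_one[OF u this]
    obtain L1 L2 where "{l. outer_common_tangent a c l} = {L1, L2}"
      "card (d \<inter> L1) = 1" "L1 \<noteq> L2 \<longrightarrow> card (frontier d \<inter> L2) = 2"
    proof
      assume "A u1 = D u1 \<and> A u2 < D u2"
      then show ?thesis using that[OF tangents] cross[OF u] by blast
    next
      assume "A u2 = D u2 \<and> A u1 < D u1"
      then show ?thesis
        using that[OF tangents[unfolded insert_commute[of "L u1"]]]
          cross[OF u(2,1) u(3)[symmetric] u(5,4)] by blast
    qed
    then have "limit_case2 a d c" unfolding limit_case2_def using c2 cen by blast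
    then show ?thesis ..
  qed simp
qed

end
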